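(* Let $p\ge 1$, let $\boldsymbol{\Sigma}\in\mathbb{R}^{p\times p}$ be a (positive definite) covariance matrix with precision matrix $\boldsymbol{\Omega}=\boldsymbol{\Sigma}^{-1}$, and suppose $\boldsymbol{\Omega}\in\mathcal{U}_q(s_p,M_p)$ for some $0\le q<1$. Let $\widehat{\boldsymbol{\Sigma}}\in\mathbb{R}^{p\times p}$ be an arbitrary (symmetric) estimator of $\boldsymbol{\Sigma}$, and let $\lambda\ge0$ satisfy $$\lambda\ \ge\ 3\|\boldsymbol{\Omega}\|_{L_1}\|\widehat{\boldsymbol{\Sigma}}-\boldsymbol{\Sigma}\|_\infty\qquad\text{and}\qquad \|\boldsymbol{\Omega}\|_{L_1}^{-q}\lambda^{1-q}s_p\ \le\ \tfrac12 .$$ Let $\tilde{\boldsymbol{\Omega}}$ be the symmetrized SCIO estimator computed from $\widehat{\boldsymbol{\Sigma}}$ with tuning parameter $\lambda$. Then $$\|\tilde{\boldsymbol{\Omega}}-\boldsymbol{\Omega}\|_\infty\le 4\,\|\boldsymbol{\Omega}\|_{L_1}\,\lambda\qquad\text{and}\qquad \|\tilde{\boldsymbol{\Omega}}-\boldsymbol{\Omega}\|_{L_1}\le 66\,\big(\lambda\|\boldsymbol{\Omega}\|_{L_1}\big)^{1-q}s_p .$$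
   Context: For a vector $\mathbf{a}$: $|\mathbf{a}|_1=\sum_i|a_i|$. For a matrix $\mathbf{A}=(a_{ij})$: $\|\mathbf{A}\|_\infty=\max_{i,j}|a_{ij}|$ (element-wise maximum) and $\|\mathbf{A}\|_{L_1}=\max_j\sum_i|a_{ij}|$ (maximum absolute column sum). For $0\le q<1$, $$\mathcal{U}_q(s_p,M_p)=\Big\{\boldsymbol{\Omega}=(\omega_{ij})_{p\times p}:\ \boldsymbol{\Omega}\succ 0,\ \max_{1\le j\le p}\sum_{i=1}^p|\omega_{ij}|^q\le s_p,\ \|\boldsymbol{\Omega}\|_{L_1}\le M_p\Big\},$$ where $\boldsymbol{\Omega}\succ0$ means symmetric positive definite, $s_p,M_p>0$, and for $q=0$ the convention is $|x|^0=1$ if $x\ne0$ and $|0|^0=0$. SCIO estimator: for $i=1,\dots,p$ let $\boldsymbol{e}_i$ be the $i$th column of the identity matrix and let $$\widehat{\boldsymbol{\beta}}_i\in\operatorname*{arg\,min}_{\boldsymbol{\beta}\in\mathbb{R}^p}\Big\{\tfrac12\boldsymbol{\beta}^{T}\widehat{\boldsymbol{\Sigma}}\boldsymbol{\beta}-\boldsymbol{e}_i^{T}\boldsymbol{\beta}+\lambda|\boldsymbol{\beta}|_1\Big\}$$ be a minimizer; put $\widehat{\boldsymbol{\Omega}}=(\widehat{\boldsymbol{\beta}}_1,\dots,\widehat{\boldsymbol{\beta}}_p)$ with entries denoted $\hat\beta_{ij}$. The symmetrized SCIO estimator $\tilde{\boldsymbol{\Omega}}=(\tilde\omega_{ij})_{p\times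 p}$ is defined by $\tilde\omega_{ij}=\tilde\omega_{ji}=\hat\beta_{ij}$ if $|\hat\beta_{ij}|\le|\hat\beta_{ji}|$, and $\tilde\omega_{ij}=\tilde\omega_{ji}=\hat\beta_{ji}$ otherwise (when $|\hat\beta_{ij}|=|\hat\beta_{ji}|$, one of the two values is chosen and used for both $\tilde\omega_{ij}$ and $\tilde\omega_{ji}$). *)

theory Defs
  imports "HOL-Analysis.Analysis"
begin

definition vec_l1 :: "real ^ 'n \<Rightarrow> real" where
  "vec_l1 a = (\<Sum>i\<in>UNIV. \<bar>a $ i\<bar>)"

definition mat_max_norm :: "real ^ 'n ^ 'm \<Rightarrow> real" where
  "mat_max_norm A = (MAX (i, j)\<in>UNIV. \<bar>A $ i $ j\<bar>)"

definition mat_L1_norm :: "real ^ 'n ^ 'm \<Rightarrow> real" where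
  "mat_L1_norm A = (MAX j. \<Sum>i\<in>UNIV. \<bar>A $ i $ j\<bar>)"

definition pos_def :: "real ^ 'n ^ 'n \<Rightarrow> bool" where
  "pos_def A \<longleftrightarrow> transpose A = A \<and> (\<forall>x. x \<noteq> 0 \<longrightarrow> x \<bullet> (A *v x) > 0)"

text \<open>Since \<open>0 powr a = 0\<close> for every \<open>a\<close> and \<open>x powr 0 = 1\<close> for \<open>x \<noteq> 0\<close>, the function
  \<open>powr\<close> realises exactly the convention for \<open>|x|\<close> to the power \<open>q\<close> at \<open>q = 0\<close>.\<close>

definition sparse_class :: "real \<Rightarrow> real \<Rightarrow> real \<Rightarrow> (real ^ 'n ^ 'n) set" where
  "sparse_class q s M = {\<Omega>. pos_def \<Omega> \<and>
     (MAX j. \<Sum>i\<in>UNIV. \<bar>\<Omega> $ i $ j\<bar> powr q) \<le> s \<and> mat_L1_norm \<Omega> \<le> M}"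

definition scio_objective :: "real ^ 'n ^ 'n \<Rightarrow> real \<Rightarrow> 'n \<Rightarrow> real ^ 'n \<Rightarrow> real" where
  "scio_objective S l i \<beta> = 1/2 * (\<beta> \<bullet> (S *v \<beta>)) - axis i 1 \<bullet> \<beta> + l * vec_l1 \<beta>"

text \<open>Minimizers need not be unique, so the estimators are predicates rather than functions of
  the data. The \<open>i\<close>-th minimizer is the \<open>i\<close>-th \<^emph>\<open>column\<close> of \<open>B\<close>.\<close>

definition is_scio :: "real ^ 'n ^ 'n \<Rightarrow> real \<Rightarrow> real ^ 'n ^ 'n \<Rightarrow> bool" where
  "is_scio S l B \<longleftrightarrow> (\<forall>i. is_arg_min (scio_objective S l i) (\<lambda>_. True) (column i B))"

text \<open>In case of a tie \<open>|B i j| = |B j i|\<close> either value may be used, but the same one for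
  both entries.\<close>

definition is_symmetrization :: "real ^ 'n ^ 'n \<Rightarrow> real ^ 'n ^ 'n \<Rightarrow> bool" where
  "is_symmetrization B W \<longleftrightarrow> (\<forall>i j. W $ i $ j = W $ j $ i \<and>
     (\<bar>B $ i $ j\<bar> < \<bar>B $ j $ i\<bar> \<longrightarrow> W $ i $ j = B $ i $ j) \<and>
     (\<bar>B $ i $ j\<bar> = \<bar>B $ j $ i\<bar> \<longrightarrow> W $ i $ j = B $ i $ j \<or> W $ i $ j = B $ j $ i))"

definition is_symmetrized_scio :: "real ^ 'n ^ 'n \<Rightarrow> real \<Rightarrow> real ^ 'n ^ 'n \<Rightarrow> bool" where
  "is_symmetrized_scio S l W \<longleftrightarrow> (\<exists>B. is_scio S l B \<and> is_symmetrization B W)"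

end

theory Submission
  imports Defs
begin

text \<open>Fix a column, with true value \<open>b\<close>, minimizer \<open>\<beta>\<close> and error \<open>h = \<beta> - b\<close>.
  Existence of a minimizer forces the quadratic form of \<open>\<Sigma>_hat\<close> to be positive semidefinite, as
  otherwise the objective is unbounded below. Comparing the objective at \<open>\<beta>\<close> and \<open>b\<close>, and
  using \<open>|\<Sigma>_hat b - e|\<^sub>\<infinity> \<le> \<lambda>/3\<close>, gives \<open>|\<beta>|\<^sub>1 \<le> |b|\<^sub>1 + |h|\<^sub>1/3\<close>, whence both
  \<open>|h|\<^sub>1 \<le> 3 |b|\<^sub>1\<close> and \<open>|h|\<^sub>1 \<le> 3 (\<Sum>\<^sub>k min |h\<^sub>k| |b\<^sub>k|)\<close>. Together with the stationarity condition
  \<open>|\<Sigma>_hat \<beta> - e|\<^sub>\<infinity> \<le> \<lambda>\<close> the former gives \<open>|h|\<^sub>\<infinity> \<le> 7/3 \<parallel>\<Omega>\<parallel> \<lambda>\<close>; the latter, combined with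
  \<open>min x y \<le> x\<^bsup>1-q\<^esup> y\<^bsup>q\<^esup>\<close>, gives the \<open>l\<^sub>1\<close> bound. Symmetrization costs at most a further
  \<open>2 min |b\<^sub>k| (7/3 \<parallel>\<Omega>\<parallel> \<lambda>)\<close> in each entry, because it only shrinks entries.\<close>

section \<open>Norm bounds and scalar inequalities\<close>

lemma mat_max_norm_ge: "\<bar>A $ i $ j\<bar> \<le> mat_max_norm A"
  unfolding mat_max_norm_def
  by (rule Max_ge) (auto intro!: image_eqI[where x = "(i, j)"])

lemma mat_max_norm_leI:
  assumes "\<And>i j. \<bar>A $ i $ j\<bar> \<le> c"
  shows "mat_max_norm A \<le> c"
  unfolding mat_max_norm_def using assms by (subst Max_le_iff) auto

lemma mat_L1_norm_ge: "(\<Sum>i\<in>UNIV. \<bar>A $ i $ j\<bar>) \<le> mat_L1_norm A"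
  unfolding mat_L1_norm_def by (rule Max_ge) auto

lemma mat_L1_norm_leI:
  assumes "\<And>j. (\<Sum>i\<in>UNIV. \<bar>A $ i $ j\<bar>) \<le> c"
  shows "mat_L1_norm A \<le> c"
  unfolding mat_L1_norm_def using assms by (subst Max_le_iff) auto

lemma mat_max_norm_nonneg: "0 \<le> mat_max_norm A"
  using mat_max_norm_ge[of A undefined undefined] by linarith

lemma mat_L1_norm_nonneg: "0 \<le> mat_L1_norm A"
  using order_trans[OF sum_nonneg mat_L1_norm_ge[of A undefined]] by auto

lemma vec_l1_nonneg: "0 \<le> vec_l1 x"
  unfolding vec_l1_def by (simp add: sum_nonneg)

lemma vec_l1_triangle: "vec_l1 (x + y) \<le> vec_l1 x + vec_l1 y"
  unfolding vec_l1_def sum.distrib[symmetric] by (rule sum_mono) auto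

lemma vec_l1_scaleR: "vec_l1 (t *\<^sub>R x) = \<bar>t\<bar> * vec_l1 x"
  unfolding vec_l1_def sum_distrib_left by (simp add: abs_mult)

lemma vec_l1_axis: "vec_l1 (axis k t) = \<bar>t\<bar>"
  unfolding vec_l1_def axis_def by (simp add: if_distrib[of abs] cong: if_cong)

lemma inner_axis_eq: "(axis k t :: real ^ 'n) \<bullet> v = t * v $ k"
  by (simp add: inner_commute[of "axis k t"] inner_axis)

lemma inner_le_sup_l1:
  fixes x v :: "real ^ 'n"
  assumes "\<And>k. \<bar>v $ k\<bar> \<le> c"
  shows "\<bar>x \<bullet> v\<bar> \<le> c * vec_l1 x"
proof -
  have "\<bar>x \<bullet> v\<bar> \<le> (\<Sum>k\<in>UNIV. \<bar>x $ k * v $ k\<bar>)"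
    unfolding inner_vec_def by (simp add: sum_abs)
  also have "\<dots> \<le> (\<Sum>k\<in>UNIV. c * \<bar>x $ k\<bar>)"
    using assms by (intro sum_mono) (simp add: abs_mult mult.commute[of c] mult_left_mono)
  finally show ?thesis by (simp add: vec_l1_def sum_distrib_left)
qed

lemma matrix_vector_sup_bound:
  fixes x :: "real ^ 'n"
  assumes "\<And>i j. \<bar>A $ i $ j\<bar> \<le> c"
  shows "\<bar>(A *v x) $ k\<bar> \<le> c * vec_l1 x"
  using inner_le_sup_l1[of "A $ k" c x] assms
  by (simp add: matrix_vector_mul_component inner_commute)

text \<open>Entries of a product are controlled by row sums, while \<open>mat_L1_norm\<close> takes
  column sums; symmetry identifies the two.\<close>

lemma symmetric_matrix_vector_sup_bound:
  fixes v :: "real ^ 'n"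
  assumes "transpose A = A" and "\<And>k. \<bar>v $ k\<bar> \<le> c"
  shows "\<bar>(A *v v) $ k\<bar> \<le> mat_L1_norm A * c"
proof -
  have "\<bar>(A *v v) $ k\<bar> \<le> c * vec_l1 (A $ k)"
    using inner_le_sup_l1[of v c "A $ k"] assms(2) by (simp add: matrix_vector_mul_component)
  also have "vec_l1 (A $ k) = (\<Sum>i\<in>UNIV. \<bar>transpose A $ i $ k\<bar>)"
    by (simp add: vec_l1_def transpose_def)
  also have "c * \<dots> \<le> c * mat_L1_norm A"
    unfolding assms(1) using assms(2)[of k] by (intro mult_left_mono mat_L1_norm_ge) auto
  finally show ?thesis by (simp add: mult.commute)
qed

text \<open>For positive arguments, split the minimum into its own powers \<open>1 - q\<close> and
  \<open>q\<close>, then enlarge each factor by monotonicity.\<close>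

lemma min_le_powr_mult:
  fixes x y q :: real
  assumes "0 \<le> x" "0 \<le> y" "0 \<le> q" "q < 1"
  shows "min x y \<le> x powr (1 - q) * y powr q"
proof (cases "x = 0 \<or> y = 0")
  case False
  then have pos: "0 < x" "0 < y" using assms by auto
  have "min x y = min x y powr (1 - q) * min x y powr q"
    using pos by (simp add: powr_add[symmetric])
  also have "\<dots> \<le> x powr (1 - q) * y powr q"
    using assms pos by (intro mult_mono powr_mono2) auto
  finally show ?thesis .
qed (use assms in auto)

text \<open>The two claims are the limits \<open>t\<close> to 0 and \<open>t\<close> to infinity,
  made explicit by concrete values of \<open>t\<close>.\<close>

lemma nonneg_of_affine_nonneg:
  fixes a c :: real
  assumes "\<And>t. 0 < t \<Longrightarrow> 0 \<le> a + t * c"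
  shows "0 \<le> a" "0 \<le> c"
proof -
  show "0 \<le> a"
  proof (rule ccontr)
    assume "\<not> 0 \<le> a"
    \<comment> \<open>This \<open>t\<close> is so small that \<open>t * c\<close> cannot make up for
      more than half of the negative \<open>a\<close>.\<close>
    moreover have "0 \<le> a + (- a / (2 * (\<bar>c\<bar> + 1))) * c"
      using \<open>\<not> 0 \<le> a\<close> by (intro assms divide_pos_pos) auto
    moreover have "(- a / (2 * (\<bar>c\<bar> + 1))) * c \<le> - a / 2"
    proof -
      have "(- a) * c \<le> (- a) * (\<bar>c\<bar> + 1)"
        using \<open>\<not> 0 \<le> a\<close> by (intro mult_left_mono) auto
      then show ?thesis by (simp add: field_simps)
    qed
    ultimately show False by linarith
  qed
  show "0 \<le> c"
  proof (rule ccontr)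
    assume c: "\<not> 0 \<le> c"
    have "0 \<le> a + ((\<bar>a\<bar> + 1) / - c) * c"
      using c by (intro assms divide_pos_pos) auto
    then show False using c by simp
  qed
qed

section \<open>Optimality conditions and the error of one column\<close>

lemma scio_objective_add:
  fixes S :: "real ^ 'n ^ 'n"
  assumes "transpose S = S"
  shows "scio_objective S l i (b + x) = scio_objective S l i b
    + 1/2 * (x \<bullet> (S *v x)) + x \<bullet> (S *v b - axis i 1) + l * (vec_l1 (b + x) - vec_l1 b)"
proof -
  have "b \<bullet> (S *v x) = x \<bullet> (S *v b)"
    by (metis assms dot_lmul_matrix inner_commute vector_transpose_matrix)
  then show ?thesis
    unfolding scio_objective_def
    by (simp add: matrix_vector_right_distrib inner_add_left inner_add_right inner_diff_right
        inner_commute[of x "axis i 1"] algebra_simps)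
qed

text \<open>Moving from \<beta> by \<open>t *\<^sub>R x\<close> and dividing the increase by
  \<open>t\<close> leaves a lower bound of 0 for an affine function of \<open>t\<close>. Its
  constant term gives stationarity, its slope semidefiniteness.\<close>

lemma scio_minimizer_conditions:
  fixes S :: "real ^ 'n ^ 'n"
  assumes S: "transpose S = S" and l: "0 \<le> l"
    and min: "is_arg_min (scio_objective S l i) (\<lambda>_. True) \<beta>"
  shows scio_minimizer_stationary: "\<bar>(S *v \<beta> - axis i 1) $ k\<bar> \<le> l"
    and scio_minimizer_psd: "0 \<le> x \<bullet> (S *v x)"
proof -
  let ?g = "S *v \<beta> - axis i 1"
  have affine: "0 \<le> (x \<bullet> ?g + l * vec_l1 x) + t * (1/2 * (x \<bullet> (S *v x)))"
    if t: "0 < t" for t x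
  proof -
    have "scio_objective S l i \<beta> \<le> scio_objective S l i (\<beta> + t *\<^sub>R x)"
      using min by (auto simp: is_arg_min_def not_less)
    then have "0 \<le> 1/2 * (t *\<^sub>R x \<bullet> (S *v (t *\<^sub>R x))) + t *\<^sub>R x \<bullet> ?g
        + l * (vec_l1 (\<beta> + t *\<^sub>R x) - vec_l1 \<beta>)"
      by (simp add: scio_objective_add[OF S])
    also have "\<dots> \<le> 1/2 * (t *\<^sub>R x \<bullet> (S *v (t *\<^sub>R x))) + t *\<^sub>R x \<bullet> ?g + l * (t * vec_l1 x)"
      using vec_l1_triangle[of \<beta> "t *\<^sub>R x"] t l
      by (intro add_left_mono mult_left_mono) (auto simp: vec_l1_scaleR)
    also have "\<dots> = t * ((x \<bullet> ?g + l * vec_l1 x) + t * (1/2 * (x \<bullet> (S *v x))))"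
      by (simp add: matrix_vector_mult_scaleR algebra_simps)
    finally show ?thesis using t by (simp only: zero_le_mult_iff) auto
  qed
  have "0 \<le> x \<bullet> ?g + l * vec_l1 x" for x
    by (rule nonneg_of_affine_nonneg(1)[OF affine])
  \<comment> \<open>The two opposite coordinate directions give the two sides of the absolute
    value.\<close>
  from this[of "axis k 1"] this[of "axis k (- 1)"]
  show "\<bar>?g $ k\<bar> \<le> l" by (simp only: inner_axis_eq vec_l1_axis)
  have "0 \<le> 1/2 * (x \<bullet> (S *v x))"
    by (rule nonneg_of_affine_nonneg(2)[OF affine])
  then show "0 \<le> x \<bullet> (S *v x)" by simp
qed

lemma scio_column_error:
  fixes S \<Sigma> \<Omega> :: "real ^ 'n ^ 'n"
  assumes S: "transpose S = S" and \<Omega>: "transpose \<Omega> = \<Omega>"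
    and inv: "\<Sigma> ** \<Omega> = mat 1" "\<Omega> ** \<Sigma> = mat 1"
    and l: "0 \<le> l" "3 * mat_L1_norm \<Omega> * mat_max_norm (S - \<Sigma>) \<le> l"
    and min: "is_arg_min (scio_objective S l i) (\<lambda>_. True) \<beta>"
  defines "b \<equiv> column i \<Omega>"
  shows "\<bar>(\<beta> - b) $ k\<bar> \<le> 7/3 * (mat_L1_norm \<Omega> * l)"
    and "vec_l1 (\<beta> - b) \<le> 3 * (\<Sum>k\<in>UNIV. min \<bar>(\<beta> - b) $ k\<bar> \<bar>b $ k\<bar>)"
proof -
  define h where "h = \<beta> - b"
  let ?L = "mat_L1_norm \<Omega>" and ?d = "mat_max_norm (S - \<Sigma>)"
  have b1: "vec_l1 b \<le> ?L"
    using mat_L1_norm_ge[of \<Omega> i] by (simp add: vec_l1_def b_def column_def)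
  have \<Sigma>b: "\<Sigma> *v b = axis i 1"
    by (metis b_def inv(1) matrix_vector_mul_assoc matrix_vector_mul_lid matrix_vector_mult_basis)
  have Sb: "\<bar>(S *v b - axis i 1) $ k\<bar> \<le> l / 3" for k
  proof -
    have "S *v b - axis i 1 = (S - \<Sigma>) *v b"
      by (simp add: \<Sigma>b[symmetric] matrix_vector_mult_diff_rdistrib)
    then have "\<bar>(S *v b - axis i 1) $ k\<bar> \<le> ?d * vec_l1 b"
      by (simp only: matrix_vector_sup_bound[OF mat_max_norm_ge])
    also have "\<dots> \<le> ?d * ?L" by (intro mult_left_mono b1 mat_max_norm_nonneg)
    finally show ?thesis using l(2) by (simp add: algebra_simps)
  qed
  have \<Sigma>h: "\<bar>(\<Sigma> *v h) $ k\<bar> \<le> 4/3 * l + ?d * vec_l1 h" for k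
  proof -
    have "\<Sigma> *v h = (S *v \<beta> - axis i 1) - (S *v b - axis i 1) - (S - \<Sigma>) *v h"
      by (simp add: h_def matrix_vector_mult_diff_rdistrib matrix_vector_mult_diff_distrib)
    then have "(\<Sigma> *v h) $ k
        = (S *v \<beta> - axis i 1) $ k - (S *v b - axis i 1) $ k - ((S - \<Sigma>) *v h) $ k"
      by simp
    moreover have "\<bar>((S - \<Sigma>) *v h) $ k\<bar> \<le> ?d * vec_l1 h"
      by (rule matrix_vector_sup_bound[OF mat_max_norm_ge])
    ultimately show ?thesis
      using scio_minimizer_stationary[OF S l(1) min, of k] Sb[of k] by linarith
  qed
  \<comment> \<open>Applying \<Omega> to \<open>\<Sigma> *v h\<close> recovers \<open>h\<close>; the
    lower bound on \<open>l\<close> turns \<open>?L * ?d\<close> into at most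
    \<open>l / 3\<close>.\<close>
  have h_sup: "\<bar>h $ k\<bar> \<le> 4/3 * (?L * l) + l / 3 * vec_l1 h" for k
  proof -
    have "\<bar>(\<Omega> *v (\<Sigma> *v h)) $ k\<bar> \<le> ?L * (4/3 * l + ?d * vec_l1 h)"
      by (rule symmetric_matrix_vector_sup_bound[OF \<Omega> \<Sigma>h])
    then have "\<bar>h $ k\<bar> \<le> 4/3 * (?L * l) + (?L * ?d) * vec_l1 h"
      by (simp add: matrix_vector_mul_assoc inv algebra_simps)
    also have "(?L * ?d) * vec_l1 h \<le> l / 3 * vec_l1 h"
      using l(2) by (intro mult_right_mono vec_l1_nonneg) auto
    finally show ?thesis by simp
  qed
  have cone: "vec_l1 \<beta> \<le> vec_l1 b + vec_l1 h / 3" if "0 < l"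
  proof -
    have "scio_objective S l i (b + h) \<le> scio_objective S l i b"
      using min by (auto simp: is_arg_min_def not_less h_def)
    then have "1/2 * (h \<bullet> (S *v h)) + h \<bullet> (S *v b - axis i 1)
        + l * (vec_l1 \<beta> - vec_l1 b) \<le> 0"
      by (simp add: scio_objective_add[OF S]) (simp add: h_def)
    moreover have "\<bar>h \<bullet> (S *v b - axis i 1)\<bar> \<le> l / 3 * vec_l1 h"
      by (rule inner_le_sup_l1[OF Sb])
    moreover have "0 \<le> h \<bullet> (S *v h)"
      by (rule scio_minimizer_psd[OF S l(1) min])
    ultimately have "l * (vec_l1 \<beta> - vec_l1 b) \<le> l * (vec_l1 h / 3)" by linarith
    then show ?thesis using that by simp
  qed
  \<comment> \<open>The cone inequality says nothing when \<open>l = 0\<close>, but then \<open>h = 0\<close>.\<close>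
  have h0: "h = 0" if "l = 0" using h_sup that by (simp add: vec_eq_iff)
  have "vec_l1 h \<le> 3 * ?L"
  proof (cases "l = 0")
    case True
    then show ?thesis using h0 mat_L1_norm_nonneg[of \<Omega>] by (simp add: vec_l1_def)
  next
    case False
    \<comment> \<open>With \<open>cone\<close> the right side is at most
      \<open>2 * vec_l1 b + vec_l1 h / 3\<close>, and solving for \<open>vec_l1 h\<close> gives the
      factor 3.\<close>
    have "vec_l1 h \<le> vec_l1 \<beta> + vec_l1 b"
      using vec_l1_triangle[of \<beta> "(- 1) *\<^sub>R b"] by (simp only: vec_l1_scaleR) (simp add: h_def)
    then show ?thesis using cone b1 False l(1) by linarith
  qed
  then have "l / 3 * vec_l1 h \<le> l / 3 * (3 * ?L)"
    using l(1) by (intro mult_left_mono) auto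
  then show "\<bar>(\<beta> - b) $ k\<bar> \<le> 7/3 * (?L * l)"
    using h_sup[of k] by (simp add: h_def algebra_simps)
  have "vec_l1 h \<le> 3 * (\<Sum>k\<in>UNIV. min \<bar>h $ k\<bar> \<bar>b $ k\<bar>)"
  proof (cases "l = 0")
    case True
    then show ?thesis using h0 by (simp add: vec_l1_def)
  next
    case False
    \<comment> \<open>By \<open>cone\<close> the left side is at least
      \<open>2/3 * vec_l1 h\<close>. Each summand on the right is bounded by the triangle inequality
      for \<open>\<beta> = b + h\<close>, used in both directions.\<close>
    have "vec_l1 h + vec_l1 b - vec_l1 \<beta> = (\<Sum>k\<in>UNIV. \<bar>h $ k\<bar> + \<bar>b $ k\<bar> - \<bar>\<beta> $ k\<bar>)"
      by (simp add: vec_l1_def sum.distrib sum_subtractf)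
    also have "\<dots> \<le> (\<Sum>k\<in>UNIV. 2 * min \<bar>h $ k\<bar> \<bar>b $ k\<bar>)"
      by (rule sum_mono) (auto simp: h_def min_def)
    finally show ?thesis using cone False l(1) by (simp add: sum_distrib_left[symmetric])
  qed
  then show "vec_l1 (\<beta> - b) \<le> 3 * (\<Sum>k\<in>UNIV. min \<bar>(\<beta> - b) $ k\<bar> \<bar>b $ k\<bar>)"
    by (simp add: h_def)
qed

text \<open>Here sparsity enters: capping \<open>f\<close> at \<open>K\<close> lets the powers of
  \<open>g\<close> be summed. It serves both the column errors and the constant function
  \<open>K\<close>.\<close>

lemma sum_min_le_powr:
  fixes f g :: "'a \<Rightarrow> real"
  assumes "0 \<le> q" "q < 1" and "\<And>k. 0 \<le> f k" "\<And>k. f k \<le> K"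
    and "(\<Sum>k\<in>A. \<bar>g k\<bar> powr q) \<le> s" and "0 \<le> K"
  shows "(\<Sum>k\<in>A. min (f k) \<bar>g k\<bar>) \<le> K powr (1 - q) * s"
proof -
  have "(\<Sum>k\<in>A. min (f k) \<bar>g k\<bar>) \<le> (\<Sum>k\<in>A. K powr (1 - q) * \<bar>g k\<bar> powr q)"
  proof (rule sum_mono)
    fix k
    have "min (f k) \<bar>g k\<bar> \<le> min K \<bar>g k\<bar>" using assms(4)[of k] by auto
    also have "\<dots> \<le> K powr (1 - q) * \<bar>g k\<bar> powr q"
      using assms by (intro min_le_powr_mult) auto
    finally show "min (f k) \<bar>g k\<bar> \<le> K powr (1 - q) * \<bar>g k\<bar> powr q" .
  qed
  also have "\<dots> \<le> K powr (1 - q) * s"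
    unfolding sum_distrib_left[symmetric] using assms by (intro mult_left_mono) auto
  finally show ?thesis .
qed

section \<open>Inversion, symmetrization and the final bounds\<close>

lemma pos_def_invertible:
  fixes A :: "real ^ 'n ^ 'n"
  assumes "pos_def A"
  shows "invertible A"
proof -
  have "\<And>x. A *v x = 0 \<Longrightarrow> x = 0"
    using assms unfolding pos_def_def by (metis inner_zero_right less_irrefl)
  then show ?thesis
    by (simp add: invertible_left_inverse matrix_left_invertible_ker)
qed

lemma matrix_inv_mult:
  assumes "invertible A"
  shows "A ** matrix_inv A = mat 1" "matrix_inv A ** A = mat 1"
  using someI_ex[OF assms[unfolded invertible_def]] by (simp_all add: matrix_inv_def)

text \<open>The case \<open>\<bar>B $ j $ i\<bar> < \<bar>B $ i $ j\<bar>\<close> comes from the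
  defining clause with the indices exchanged and the symmetry of \<open>W\<close>.\<close>

lemma symmetrization_cases:
  assumes "is_symmetrization B W"
  shows "W $ i $ j = B $ i $ j \<or> W $ i $ j = B $ j $ i"
  using assms unfolding is_symmetrization_def by (metis linorder_cases)

lemma symmetrization_abs_le:
  assumes "is_symmetrization B W"
  shows "\<bar>W $ i $ j\<bar> \<le> \<bar>B $ i $ j\<bar>"
  using assms unfolding is_symmetrization_def
  by (metis less_eq_real_def linorder_cases)

theorem theorem2:
  fixes \<Sigma> \<Omega> \<Sigma>_hat \<Omega>_tilde :: "real ^ 'p ^ 'p"
    and q s M lam :: real
  assumes "pos_def \<Sigma>"
    and "\<Omega> = matrix_inv \<Sigma>"
    and "0 \<le> q" and "q < 1"
    and "s > 0" and "M > 0"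
    and "\<Omega> \<in> sparse_class q s M"
    and "transpose \<Sigma>_hat = \<Sigma>_hat"
    and "lam \<ge> 0"
    and "lam \<ge> 3 * mat_L1_norm \<Omega> * mat_max_norm (\<Sigma>_hat - \<Sigma>)"
    and "mat_L1_norm \<Omega> powr (- q) * lam powr (1 - q) * s \<le> 1/2"
    and "is_symmetrized_scio \<Sigma>_hat lam \<Omega>_tilde"
  shows "mat_max_norm (\<Omega>_tilde - \<Omega>) \<le> 4 * mat_L1_norm \<Omega> * lam
    \<and> mat_L1_norm (\<Omega>_tilde - \<Omega>) \<le> 66 * (lam * mat_L1_norm \<Omega>) powr (1 - q) * s"
proof -
  obtain B where B: "is_scio \<Sigma>_hat lam B" and W: "is_symmetrization B \<Omega>_tilde"
    using assms unfolding is_symmetrized_scio_def by blast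
  have \<Omega>: "transpose \<Omega> = \<Omega>"
    using assms by (simp add: sparse_class_def pos_def_def)
  then have \<Omega>_sym: "\<Omega> $ i $ j = \<Omega> $ j $ i" for i j
    by (metis transpose_def vec_lambda_beta)
  have sparse: "(\<Sum>i\<in>UNIV. \<bar>\<Omega> $ i $ j\<bar> powr q) \<le> s" for j
    using assms by (simp add: sparse_class_def)
  note inv = matrix_inv_mult[OF pos_def_invertible[OF assms(1)], folded assms(2)]
  let ?R = "lam * mat_L1_norm \<Omega>"
  define K where "K = 7/3 * ?R"
  have R0: "0 \<le> ?R" using assms(9) mat_L1_norm_nonneg[of \<Omega>] by simp
  then have K0: "0 \<le> K" by (simp add: K_def)
  have min: "is_arg_min (scio_objective \<Sigma>_hat lam j) (\<lambda>_. True) (column j B)" for j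
    using B by (simp add: is_scio_def)
  note column_error = scio_column_error[OF assms(8) \<Omega> inv assms(9,10) min]
  have B_sup: "\<bar>B $ i $ j - \<Omega> $ i $ j\<bar> \<le> K" for i j
    using column_error(1)[of j i] by (simp add: column_def K_def mult.commute)
  have B_l1: "(\<Sum>i\<in>UNIV. \<bar>B $ i $ j - \<Omega> $ i $ j\<bar>) \<le> 3 * (K powr (1 - q) * s)" for j
  proof -
    have "(\<Sum>i\<in>UNIV. \<bar>B $ i $ j - \<Omega> $ i $ j\<bar>)
        \<le> 3 * (\<Sum>i\<in>UNIV. min \<bar>B $ i $ j - \<Omega> $ i $ j\<bar> \<bar>\<Omega> $ i $ j\<bar>)"
      using column_error(2)[of j] by (simp add: column_def vec_l1_def)
    also have "(\<Sum>i\<in>UNIV. min \<bar>B $ i $ j - \<Omega> $ i $ j\<bar> \<bar>\<Omega> $ i $ j\<bar>) \<le> K powr (1 - q) * s"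
      using assms(3,4) B_sup sparse K0 by (intro sum_min_le_powr) auto
    finally show ?thesis by simp
  qed
  have W_sup: "\<bar>\<Omega>_tilde $ i $ j - \<Omega> $ i $ j\<bar> \<le> K" for i j
    using symmetrization_cases[OF W, of i j] B_sup[of i j] B_sup[of j i] \<Omega>_sym[of i j] by auto
  have W_l1: "(\<Sum>i\<in>UNIV. \<bar>\<Omega>_tilde $ i $ j - \<Omega> $ i $ j\<bar>) \<le> 5 * (K powr (1 - q) * s)" for j
  proof -
    have "(\<Sum>i\<in>UNIV. \<bar>\<Omega>_tilde $ i $ j - \<Omega> $ i $ j\<bar>)
        \<le> (\<Sum>i\<in>UNIV. \<bar>B $ i $ j - \<Omega> $ i $ j\<bar> + 2 * min K \<bar>\<Omega> $ i $ j\<bar>)"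
    proof (rule sum_mono)
      fix i
      \<comment> \<open>If the minimum is \<open>K\<close>, \<open>W_sup\<close> suffices. Otherwise
        the left side is at most
        \<open>\<bar>B $ i $ j\<bar> + \<bar>\<Omega> $ i $ j\<bar>\<close>, as symmetrization does
        not enlarge entries; compare \<open>B\<close> with \<Omega> once more.\<close>
      show "\<bar>\<Omega>_tilde $ i $ j - \<Omega> $ i $ j\<bar> \<le> \<bar>B $ i $ j - \<Omega> $ i $ j\<bar> + 2 * min K \<bar>\<Omega> $ i $ j\<bar>"
        using symmetrization_abs_le[OF W, of i j] W_sup[of i j] by (auto simp: min_def)
    qed
    also have "\<dots> = (\<Sum>i\<in>UNIV. \<bar>B $ i $ j - \<Omega> $ i $ j\<bar>) + 2 * (\<Sum>i\<in>UNIV. min K \<bar>\<Omega> $ i $ j\<bar>)"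
      by (simp add: sum.distrib sum_distrib_left)
    also have "\<dots> \<le> 3 * (K powr (1 - q) * s) + 2 * (K powr (1 - q) * s)"
      using assms(3,4) sparse K0 by (intro add_mono mult_left_mono B_l1 sum_min_le_powr) auto
    finally show ?thesis by linarith
  qed
  have "K powr (1 - q) \<le> 7/3 * ?R powr (1 - q)"
  proof -
    \<comment> \<open>The exponent is at most 1 and the base exceeds 1, so the final constant is
      \<open>5 * 7/3 = 35/3\<close>, well below 66.\<close>
    have "(7/3 :: real) powr (1 - q) \<le> (7/3) powr 1"
      using assms(3) by (intro powr_mono) auto
    then have "(7/3) powr (1 - q) * ?R powr (1 - q) \<le> 7/3 * ?R powr (1 - q)"
      by (intro mult_right_mono) auto
    then show ?thesis
      unfolding K_def by (subst powr_mult)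
  qed
  then have "5 * (K powr (1 - q) * s) \<le> 5 * (7/3 * ?R powr (1 - q) * s)"
    using assms(5) by (intro mult_left_mono mult_right_mono) auto
  also have "\<dots> \<le> 66 * ?R powr (1 - q) * s" using assms(5) by simp
  finally have "mat_L1_norm (\<Omega>_tilde - \<Omega>) \<le> 66 * ?R powr (1 - q) * s"
    using W_l1 by (intro mat_L1_norm_leI) (auto intro: order_trans)
  moreover have "mat_max_norm (\<Omega>_tilde - \<Omega>) \<le> K"
    using W_sup by (intro mat_max_norm_leI) simp
  ultimately show ?thesis using R0 by (simp add: K_def mult.commute mult.assoc)
qed

end
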